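(* Let $c=0$ and let $z_0\in\mathbb{R}$ satisfy $z_0\neq 0$ and $z_0\neq 1$. Then the Exponent Set $E(z_0,0)$ admits no finite universal escape radius. More precisely, for every real $r>0$ there exists an exponent $x\in E(z_0,0)$ such that the orbit generated by $z_{n+1}=z_n^{\,x}$ from $z_0$ satisfies $|z_n|>r$ for some $n\ge 0$, while the orbit remains bounded.
   Context: Complex powers: for $z\in\mathbb{C}\setminus\{0\}$ let $\log z=\ln|z|+i\operatorname{Arg}(z)$ with $\operatorname{Arg}(z)\in(-\pi,\pi]$ (so $\operatorname{Arg}(-a)=\pi$ for $a>0$), and for $x\in\mathbb{C}$ set $z^x=\exp(x\log z)$. For $z=0$: $0^x=0$ if $\operatorname{Re}(x)>0$, and $0^x$ is undefined if $\operatorname{Re}(x)\le 0$. For $(z_0,c,x)\in\mathbb{C}^3$, the orbit $\{z_n\}$ is generated by $z_{n+1}=z_n^{\,x}+c$, continuing as long as the next iterate is defined and terminating otherwise. Exponent Set: for fixed $z_0,c\in\mathbb{C}$, $E(z_0,c)$ is the set of all $x\in\mathbb{C}$ such that $z_n$ is defined for every $n\ge 0$ and $\sup_{n\ge0}|z_n|<\infty$. Universal escape radius: for fixed $z_0,c\in\mathbb{C}$, a finite number $r>0$ is called a universal escape radius for $E(z_0,c)$ if, for every $x\in\mathbb{C}$ for which the orbit is well-defined for all $n\ge 0$, the existence of some $n\ge0$ with $|z_n|>r$ implies $x\notin E(z_0,c)$. *)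

theory Defs
  imports "HOL-Analysis.Analysis"
begin

text \<open>
  For \<open>z \<noteq> 0\<close> the complex \<open>powr\<close> of the library is \<open>exp (x * Ln z)\<close>, with the imaginary part of
  \<open>Ln z\<close> in \<open>(-pi, pi]\<close>. The library totalises it by \<open>0 powr x = 0\<close> for every \<open>x\<close>;
  here \<open>None\<close> stands for an undefined power.
\<close>

definition cpow :: "complex \<Rightarrow> complex \<Rightarrow> complex option" where
  "cpow z x = (if z = 0 then (if Re x > 0 then Some 0 else None) else Some (z powr x))"

text \<open>The value \<open>None\<close> at \<open>n\<close> means that the orbit has terminated before \<open>n\<close>.\<close>

primrec orbit :: "complex \<Rightarrow> complex \<Rightarrow> complex \<Rightarrow> nat \<Rightarrow> complex option" where
  "orbit z0 c x 0 = Some z0"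
| "orbit z0 c x (Suc n) =
     (case orbit z0 c x n of None \<Rightarrow> None | Some z \<Rightarrow> map_option (\<lambda>w. w + c) (cpow z x))"

definition orbit_defined :: "complex \<Rightarrow> complex \<Rightarrow> complex \<Rightarrow> bool" where
  "orbit_defined z0 c x \<longleftrightarrow> (\<forall>n. orbit z0 c x n \<noteq> None)"

text \<open>Only meaningful for indices at which the orbit is defined.\<close>

definition iterate :: "complex \<Rightarrow> complex \<Rightarrow> complex \<Rightarrow> nat \<Rightarrow> complex" where
  "iterate z0 c x n = the (orbit z0 c x n)"

definition orbit_bounded :: "complex \<Rightarrow> complex \<Rightarrow> complex \<Rightarrow> bool" where
  "orbit_bounded z0 c x \<longleftrightarrow> bdd_above (range (\<lambda>n. norm (iterate z0 c x n)))"

definition Exponent_Set :: "complex \<Rightarrow> complex \<Rightarrow> complex set" where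
  "Exponent_Set z0 c = {x. orbit_defined z0 c x \<and> orbit_bounded z0 c x}"

definition universal_escape_radius :: "complex \<Rightarrow> complex \<Rightarrow> real \<Rightarrow> bool" where
  "universal_escape_radius z0 c r \<longleftrightarrow>
     r > 0 \<and>
     (\<forall>x. orbit_defined z0 c x \<longrightarrow> (\<exists>n. norm (iterate z0 c x n) > r) \<longrightarrow> x \<notin> Exponent_Set z0 c)"

end

theory Submission
  imports Defs
begin

text \<open>
  Large exponents can still give bounded orbits, because an orbit may climb as high as desired in
  its first step and then land exactly on the fixed point \<open>1\<close>.

  Write \<open>L = Ln z0\<close> and suppose that \<open>x * L = u + 2 * pi * \<i> * k\<close> with \<open>k\<close> an integer and \<open>Im u\<close> in
  \<open>(-pi, pi]\<close>. Then the first iterate is \<open>exp u\<close>, its principal logarithm is \<open>u\<close>, and the second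
  iterate is \<open>exp (x * u)\<close>. This equals \<open>1\<close> exactly when \<open>x * u = 2 * pi * \<i> * m\<close> for an integer
  \<open>m\<close>, that is, when \<open>u * (u + 2 * pi * \<i> * k) = 2 * pi * \<i> * m * L\<close>. So everything reduces to
  solving this equation with \<open>Re u\<close> as large as desired (lemma \<open>landing_equation_solvable\<close>).

  If \<open>m\<close> is allowed to be real, the solutions for a fixed \<open>k\<close> form a curve, along which \<open>m\<close> varies
  continuously. When \<open>k\<close> has a suitable sign and \<open>\<bar>k\<bar>\<close> is large, \<open>Re u\<close> is large and \<open>m\<close> varies by at
  least \<open>1\<close> on a part of the curve with \<open>\<bar>Im u\<bar>\<close> between \<open>1\<close> and \<open>2\<close>, so it takes an integer value
  there (lemma \<open>root_times_parameter_hits_multiple\<close>). This needs \<open>Re L \<noteq> 0\<close>; on the unit circle, where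
  \<open>L\<close> is purely imaginary, \<open>k = 0\<close> and a real \<open>u\<close> suffice. The argument works for all complex
  \<open>z0\<close> other than \<open>0\<close> and \<open>1\<close>.
\<close>

text \<open>
  The intermediate value step. The number \<open>a\<close> below is the positive root of
  \<open>a\<^sup>2 - 2 * t * Q * a = Q\<^sup>2 - (pi * K)\<^sup>2\<close>, which for \<open>Q \<ge> pi * K + 1\<close> is at least
  \<open>sqrt (2 * pi * K)\<close> and does not decrease with \<open>Q\<close>. Hence \<open>a * Q\<close> increases by at least
  \<open>sqrt (2 * pi * K)\<close> on the interval of length \<open>1\<close> below, and this exceeds the spacing \<open>s\<close> once
  \<open>K\<close> is large.
\<close>

lemma root_times_parameter_hits_multiple:
  fixes t s R :: real
  assumes "t \<ge> 0" and "s > 0"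
  obtains K :: nat and Q a :: real and M :: int
  where "pi * K + 1 \<le> Q" and "Q \<le> pi * K + 2" and "a \<ge> R"
    and "a\<^sup>2 - 2 * t * Q * a = Q\<^sup>2 - (pi * K)\<^sup>2" and "a * Q = s * M"
proof -
  obtain K :: nat where K: "(max R s)\<^sup>2 < real K"
    using reals_Archimedean2 by blast
  define A where "A = (\<lambda>Q. t * Q + sqrt ((t * Q)\<^sup>2 + (Q\<^sup>2 - (pi * K)\<^sup>2)))"
  define lo where "lo = pi * K + 1"
  have lo: "lo \<ge> 1" "lo \<ge> pi * K" by (simp_all add: lo_def)
  have A_lower: "A Q \<ge> max R s" and disc: "Q\<^sup>2 - (pi * K)\<^sup>2 \<ge> 0" if "Q \<ge> lo" for Q
  proof -
    have "Q\<^sup>2 \<ge> lo\<^sup>2"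
      using that lo by (intro power_mono) auto
    moreover have "lo\<^sup>2 = (pi * K)\<^sup>2 + 2 * pi * K + 1"
      by (simp add: lo_def power2_eq_square algebra_simps)
    moreover have "2 * pi * K \<ge> real K"
      using pi_gt3 mult_right_mono[of 1 "2 * pi" "real K"] by simp
    ultimately have gap: "Q\<^sup>2 - (pi * K)\<^sup>2 \<ge> real K" by linarith
    then show "Q\<^sup>2 - (pi * K)\<^sup>2 \<ge> 0"
      by (meson of_nat_0_le_iff order_trans)
    have "(max R s)\<^sup>2 \<le> (t * Q)\<^sup>2 + (Q\<^sup>2 - (pi * K)\<^sup>2)"
      using gap K zero_le_power2[of "t * Q"] by linarith
    then have "max R s \<le> sqrt ((t * Q)\<^sup>2 + (Q\<^sup>2 - (pi * K)\<^sup>2))"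
      by (rule real_le_rsqrt)
    moreover have "t * Q \<ge> 0" using that lo assms by simp
    ultimately show "A Q \<ge> max R s" by (simp add: A_def)
  qed
  have A_mono: "A lo \<le> A (lo + 1)"
  proof -
    have tQ: "t * lo \<le> t * (lo + 1)"
      using assms by (intro mult_left_mono) auto
    moreover have "(t * lo)\<^sup>2 \<le> (t * (lo + 1))\<^sup>2"
      using tQ lo assms by (intro power_mono) auto
    moreover have "lo\<^sup>2 \<le> (lo + 1)\<^sup>2"
      using lo by (intro power_mono) auto
    ultimately show ?thesis
      unfolding A_def by (intro add_mono real_sqrt_le_mono diff_right_mono) auto
  qed
  have step: "A lo * lo / s + 1 \<le> A (lo + 1) * (lo + 1) / s"
  proof -
    have "A lo * lo + s \<le> A lo * (lo + 1)"
      using A_lower[of lo] by (simp add: algebra_simps)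
    also have "\<dots> \<le> A (lo + 1) * (lo + 1)"
      using A_mono lo by (intro mult_right_mono) auto
    finally have "(A lo * lo + s) / s \<le> A (lo + 1) * (lo + 1) / s"
      using assms by (intro divide_right_mono) auto
    then show ?thesis
      using assms by (simp add: add_divide_distrib)
  qed
  define M where "M = \<lceil>A lo * lo / s\<rceil>"
  have "\<exists>Q\<ge>lo. Q \<le> lo + 1 \<and> A Q * Q / s = of_int M"
  proof (rule IVT')
    show "A lo * lo / s \<le> of_int M" by (simp add: M_def)
    show "of_int M \<le> A (lo + 1) * (lo + 1) / s"
      using step unfolding M_def by linarith
    show "continuous_on {lo..lo + 1} (\<lambda>Q. A Q * Q / s)"
      unfolding A_def using assms by (intro continuous_intros) auto
  qed simp
  then obtain Q where Q: "Q \<ge> lo" "Q \<le> lo + 1" "A Q * Q / s = of_int M"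
    by blast
  show thesis
  proof
    show "pi * K + 1 \<le> Q" "Q \<le> pi * K + 2" using Q by (simp_all add: lo_def)
    show "A Q \<ge> R" using A_lower Q by simp
    have "(A Q - t * Q)\<^sup>2 = (t * Q)\<^sup>2 + (Q\<^sup>2 - (pi * K)\<^sup>2)"
      using disc[OF Q(1)] by (simp add: A_def)
    then show "(A Q)\<^sup>2 - 2 * t * Q * A Q = Q\<^sup>2 - (pi * K)\<^sup>2"
      by (simp add: power2_eq_square algebra_simps)
    show "A Q * Q = s * of_int M"
      using Q(3) assms by (simp add: field_simps)
  qed
qed

text \<open>
  Take \<open>Re L \<noteq> 0\<close>. With \<open>u = a + \<i> * \<sigma> * (Q - pi * K)\<close> and \<open>k = \<sigma> * K\<close>, where \<open>\<sigma>\<close> is a sign, the left-hand side below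
  is \<open>a\<^sup>2 - (Q\<^sup>2 - (pi * K)\<^sup>2) + 2 * \<i> * \<sigma> * a * Q\<close>. Comparing imaginary parts makes \<open>a * Q\<close> a multiple
  of \<open>pi * \<bar>Re L\<bar>\<close>, and comparing real parts then gives the quadratic equation for \<open>a\<close> in the
  previous lemma, with \<open>t = -\<sigma> * Im L / Re L\<close>. The sign \<open>\<sigma>\<close> is chosen to make \<open>t \<ge> 0\<close>.
\<close>

lemma landing_equation_solvable:
  fixes L :: complex and R :: real
  assumes "L \<noteq> 0"
  obtains u :: complex and k m :: int
  where "Re u \<ge> R" and "\<bar>Im u\<bar> < pi"
    and "u * (u + 2 * pi * \<i> * k) = 2 * pi * \<i> * m * L"
proof (cases "Re L = 0")
  case True
  then have "Im L \<noteq> 0" using assms by (simp add: complex_eq_iff)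
  \<comment> \<open>For real \<open>u\<close> and \<open>k = 0\<close> the equation is \<open>u\<^sup>2 = - 2 * pi * m * Im L\<close>.\<close>
  define c where "c = 2 * pi * \<bar>Im L\<bar>"
  have "c > 0" using \<open>Im L \<noteq> 0\<close> by (simp add: c_def)
  obtain N :: nat where "R\<^sup>2 / c < real N"
    using reals_Archimedean2 by blast
  then have N: "R\<^sup>2 \<le> c * N"
    using \<open>c > 0\<close> by (simp add: field_simps)
  define m :: int where "m = (if Im L > 0 then - int N else int N)"
  have "\<bar>Im L\<bar> * N = - (m * Im L)"
    by (cases "Im L > 0") (simp_all add: m_def mult.commute)
  then have cN: "c * N = - (2 * pi * m * Im L)"
    by (simp only: c_def mult.assoc mult_minus_right)
  obtain a :: real where a: "a \<ge> R" "a\<^sup>2 = c * N"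
    using real_le_rsqrt[OF N] \<open>c > 0\<close>
    by (metis less_imp_le mult_nonneg_nonneg of_nat_0_le_iff real_sqrt_pow2)
  then have sq: "a * a = - (2 * pi * m * Im L)"
    using cN by (simp add: power2_eq_square)
  show thesis
  proof
    show "Re (complex_of_real a) \<ge> R" using a by simp
    show "\<bar>Im (complex_of_real a)\<bar> < pi" by simp
    show "complex_of_real a * (complex_of_real a + 2 * pi * \<i> * (0::int)) = 2 * pi * \<i> * m * L"
      using sq True by (intro complex_eqI) simp_all
  qed
next
  case False
  define \<sigma> :: int where "\<sigma> = (if Im L / Re L \<le> 0 then 1 else -1)"
  define \<rho> :: int where "\<rho> = (if Re L > 0 then 1 else -1)"
  define t where "t = - (\<sigma> * Im L / Re L)"
  have "t \<ge> 0" by (simp add: t_def \<sigma>_def)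
  moreover have "pi * \<bar>Re L\<bar> > 0" using False by simp
  ultimately obtain K :: nat and Q a :: real and M :: int
    where KQ: "pi * K + 1 \<le> Q" "Q \<le> pi * K + 2" and a: "a \<ge> R"
      and quad: "a\<^sup>2 - 2 * t * Q * a = Q\<^sup>2 - (pi * K)\<^sup>2"
      and prod: "a * Q = pi * \<bar>Re L\<bar> * M"
    by (rule root_times_parameter_hits_multiple)
  define m where "m = \<sigma> * \<rho> * M"
  have \<sigma>: "real_of_int \<sigma> * \<sigma> = 1" and \<rho>: "\<bar>Re L\<bar> = \<rho> * Re L"
    by (simp_all add: \<sigma>_def \<rho>_def)
  have im: "2 * \<sigma> * (a * Q) = 2 * pi * m * Re L"
    unfolding prod m_def \<rho> by simp
  have re: "a\<^sup>2 - (Q\<^sup>2 - (pi * K)\<^sup>2) = - (2 * pi * m * Im L)"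
  proof -
    have "a\<^sup>2 - (Q\<^sup>2 - (pi * K)\<^sup>2) = 2 * t * (a * Q)" using quad by (simp add: algebra_simps)
    also have "\<dots> = - (2 * \<sigma> * (a * Q)) * (Im L / Re L)" by (simp add: t_def)
    also have "\<dots> = - (2 * pi * m * Im L)" unfolding im using False by simp
    finally show ?thesis .
  qed
  define u where "u = Complex a (\<sigma> * (Q - pi * K))"
  show thesis
  proof
    show "Re u \<ge> R" using a by (simp add: u_def)
    have "\<bar>Q - pi * K\<bar> < pi" using KQ pi_gt3 by linarith
    then show "\<bar>Im u\<bar> < pi" by (simp add: u_def \<sigma>_def abs_mult)
    have "Re (u * (u + 2 * pi * \<i> * (\<sigma> * int K))) = a\<^sup>2 - (\<sigma> * \<sigma>) * (Q\<^sup>2 - (pi * K)\<^sup>2)"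
      by (simp add: u_def power2_eq_square algebra_simps)
    moreover have "Im (u * (u + 2 * pi * \<i> * (\<sigma> * int K))) = 2 * \<sigma> * (a * Q)"
      by (simp add: u_def algebra_simps)
    ultimately show "u * (u + 2 * pi * \<i> * (\<sigma> * int K)) = 2 * pi * \<i> * m * L"
      using re im \<sigma> by (intro complex_eqI) simp_all
  qed
qed

lemma orbit_hits_one_above_radius:
  fixes z0 :: complex and r :: real
  assumes "z0 \<noteq> 0" and "z0 \<noteq> 1" and "r > 0"
  obtains x w where "norm w > r" and "orbit z0 0 x 1 = Some w"
    and "\<And>n. orbit z0 0 x (Suc (Suc n)) = Some 1"
proof -
  define L where "L = Ln z0"
  have z0: "z0 = exp L" using assms by (simp add: L_def)
  then have "L \<noteq> 0" using assms by auto
  then obtain u and k m :: int where u: "Re u \<ge> ln r + 1" "\<bar>Im u\<bar> < pi"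
    and eq: "u * (u + 2 * pi * \<i> * k) = 2 * pi * \<i> * m * L"
    by (rule landing_equation_solvable)
  define x where "x = (u + 2 * pi * \<i> * k) / L"
  have xL: "x * L = u + 2 * pi * \<i> * k"
    using \<open>L \<noteq> 0\<close> by (simp add: x_def)
  have xu: "x * u = 2 * pi * \<i> * m"
    using \<open>L \<noteq> 0\<close> eq by (simp add: x_def field_simps)
  have exp_period: "exp (2 * pi * \<i> * complex_of_int j) = 1" for j
    using exp_integer_2pi[of "of_int j"] by (simp add: mult.assoc mult.left_commute mult.commute)
  have "z0 powr x = exp (x * L)"
    using assms by (simp add: powr_def L_def)
  also have "\<dots> = exp u"
    by (simp only: xL exp_add exp_period mult_1_right)
  finally have first: "orbit z0 0 x 1 = Some (exp u)"
    using assms by (simp add: cpow_def)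
  have "Ln (exp u) = u" using u by (intro Ln_exp) auto
  then have "exp u powr x = 1"
    using exp_period[of m] by (simp only: powr_def xu exp_not_eq_zero if_False)
  then have "cpow (exp u) x = Some 1" by (simp add: cpow_def)
  then have rest: "orbit z0 0 x (Suc (Suc n)) = Some 1" for n
    using first by (induction n) (auto simp: cpow_def)
  have "r = exp (ln r)" using assms by simp
  also have "\<dots> < exp (Re u)" using u by (simp only: exp_less_cancel_iff)
  also have "\<dots> = norm (exp u)" by simp
  finally have "r < norm (exp u)" .
  then show thesis using first rest by (rule that)
qed

lemma exponent_with_high_bounded_orbit:
  fixes z0 :: complex and r :: real
  assumes "z0 \<noteq> 0" and "z0 \<noteq> 1" and "r > 0"
  shows "\<exists>x \<in> Exponent_Set z0 0. \<exists>n. norm (iterate z0 0 x n) > r"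
proof -
  obtain x w where w: "norm w > r" and first: "orbit z0 0 x 1 = Some w"
    and rest: "\<And>n. orbit z0 0 x (Suc (Suc n)) = Some 1"
    using orbit_hits_one_above_radius[OF assms] by metis
  have orbit: "orbit z0 0 x n \<in> {Some z0, Some w, Some 1}" for n
  proof (cases n)
    case (Suc n')
    then show ?thesis using first rest by (cases n') (auto simp del: orbit.simps(2))
  qed simp
  have "orbit_defined z0 0 x"
    unfolding orbit_defined_def using orbit by (metis empty_iff insert_iff option.distinct(1))
  moreover have "norm (iterate z0 0 x n) \<in> {norm z0, norm w, 1}" for n
    using orbit[of n] by (auto simp: iterate_def)
  then have "range (\<lambda>n. norm (iterate z0 0 x n)) \<subseteq> {norm z0, norm w, 1}"
    by blast
  then have "orbit_bounded z0 0 x"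
    unfolding orbit_bounded_def
    by (meson bdd_above_mono bdd_above_finite finite.emptyI finite.insertI)
  ultimately have "x \<in> Exponent_Set z0 0" by (simp add: Exponent_Set_def)
  moreover have "norm (iterate z0 0 x 1) > r"
    using w first by (simp add: iterate_def)
  ultimately show ?thesis by blast
qed

theorem corollary3p4:
  fixes z0 :: real
  assumes "z0 \<noteq> 0" and "z0 \<noteq> 1"
  shows "(\<nexists>r. universal_escape_radius (complex_of_real z0) 0 r) \<and>
         (\<forall>r>0. \<exists>x \<in> Exponent_Set (complex_of_real z0) 0.
            (\<exists>n. norm (iterate (complex_of_real z0) 0 x n) > r) \<and>
            orbit_bounded (complex_of_real z0) 0 x)"
proof -
  have high: "\<exists>x \<in> Exponent_Set (complex_of_real z0) 0.
      \<exists>n. norm (iterate (complex_of_real z0) 0 x n) > r" if "r > 0" for r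
    using exponent_with_high_bounded_orbit[OF _ _ that, of "complex_of_real z0"] assms by simp
  then show ?thesis
    unfolding universal_escape_radius_def Exponent_Set_def by blast
qed

end
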